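(* Let $n\in\mathbb{N}$, let $\omega$ be a modulus of continuity, $e\in\mathbb{R}^n_+$, let $M=M_\rho$ be a metric space with metric $\rho$, $\mu$ a $\sigma$-finite (non-negative) measure on the Borel $\sigma$-algebra of $M$, $M'\subset M$ compact, $(N,\nu)$ a space with $\sigma$-finite measure, $A:B_\mu(M')\to\mathfrak{M}(N,\nu)$ an integral operator with non-negative kernel $K$, $Y\subset\mathfrak{M}(N,\nu)$ a normed lattice with $A(B_\mu(M'))\subset Y$, and $Q=\{q_j\}_{j=1}^n\subset M'$ a fixed system of points. Let either $W=H^\omega_\mu(M')$, $\varphi=\tau_{\omega,Q,e}$, $L=L_{\omega,Q,e}$, or $W=\tilde H^\omega_\mu(M')$, $\varphi=\tilde\tau_{\omega,Q,e}$, $L=\tilde L_{\omega,Q,e}$. Then the method $\Phi=A\,L$ is an optimal method of recovery of the operator $A$ on the class $W$ based on information $I_Q$ with $U_e$-error, and $$\mathcal{E}(A;W;I_Q;U_e)=\mathcal{E}(A;W;I_Q;U_e;\Phi)=\left\|\int_{M'}K(\cdot,x)\,\varphi(x)\,d\mu(x)\right\|_Y .$$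
   Context: $\mathbb{R}_+=[0,\infty)$. A modulus of continuity is a function $\omega:\mathbb{R}_+\to\mathbb{R}_+$ that is continuous, non-decreasing, with $\omega(0)=0$ and $\omega(t'+t'')\le\omega(t')+\omega(t'')$. For a $\sigma$-finite measure space $(N,\nu)$, $\mathfrak{M}(N,\nu)$ is the space of $\nu$-measurable, $\nu$-a.e. finite real functions (modulo $\nu$-a.e. equality), ordered by $x'\prec x''$ iff $x'(s)\le x''(s)$ for $\nu$-a.e. $s$. A normed lattice is a real normed space that is a vector lattice and whose norm satisfies: $|x|\prec|y|$ implies $\|x\|\le\|y\|$; a normed lattice $Y\subset\mathfrak{M}(N,\nu)$ carries the order inherited from $\mathfrak{M}(N,\nu)$. A linear operator $T:E\to\mathfrak{M}(N,\nu)$, $E$ a linear manifold in $\mathfrak{M}(M,\mu)$, is an integral operator with kernel $K$ if $K(s,t)$ is a $\nu\times\mu$-measurable function and for every $x\in E$, $Tx(s)=\int_M K(s,t)x(t)\,d\mu(t)$ (Lebesgue integral) for $\nu$-a.e. $s\in N$. Classes, for compact $M'\subset M$: $B_\mu(M')$ is the set of $\mu$-essentially bounded functions $x:M\to\mathbb{R}$ with $\mathrm{supp}\,x\subset M'$. $C_\mu(M')=\{y\cdot\chi_{M'}: y:M\to\mathbb{R}\text{ continuous}\}$, where $\chi_{M'}$ is the indicator function; $\tilde C_\mu(M')=\{x:M\to\mathbb{R}\text{ continuous}: \mathrm{supp}\,x\subset M'\}$. $H^\omega_\mu(M')=\{x\in C_\mu(M'):|x(t')-x(t'')|\le\omega(\rho(t',t''))\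 \forall t',t''\in M'\}$, $\tilde H^\omega_\mu(M')=H^\omega_\mu(M')\cap\tilde C_\mu(M')$. Information: $I_Qx=(x(q_1),\dots,x(q_n))\in\mathbb{R}^n$; $U_e=[-e_1,e_1]\times\dots\times[-e_n,e_n]$. Functions: $\tau(t)=\tau_{\omega,Q,e}(t)=\min_{1\le j\le n}(e_j+\omega(\rho(t,q_j)))$ for $t\in M'$ and $\tau(t)=0$ for $t\in M\setminus M'$; $\tilde\tau(t)=\tilde\tau_{\omega,Q,e}(t)=\min\{\tau(t),\omega(\rho(t,\partial M'))\}$, $t\in M$, where $\rho(t,\partial M')=\inf_{s\in\partial M'}\rho(t,s)$ and $\partial M'$ is the boundary of $M'$ in $M$ (if $\partial M'=\emptyset$, $\omega(\rho(t,\partial M'))$ is read as $+\infty$). Generalized Voronoi cells: $\Pi'_j=\{t\in M':\tau(t)=e_j+\omega(\rho(t,q_j))\}$, $\Pi_1=\Pi'_1$, $\Pi_j=\Pi'_j\setminus\bigcup_{s=1}^{j-1}\Pi_s$ for $j=2,\dots,n$; $\tilde\Pi_0=\{t\in M':\omega(\rho(t,\partial M'))\le\tau(t)\}$, $\tilde\Pi_j=\Pi_j\setminus\tilde\Pi_0$. Operators $L_{\omega,Q,e},\tilde L_{\omega,Q,e}:\mathbb{R}^n\to B_\mu(M')$: $L_{\omega,Q,e}z(t)=z_j$ for $t\in\Pi_j$ and $0$ for $t\in M\setminus M'$; $\tilde L_{\omega,Q,e}z(t)=z_j$ for $t\in\tilde\Pi_j$, $j\ge1$, and $0$ for $t\in\tilde\Pi_0\cup(M\setminus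 M')$. Recovery: a method of recovery is an arbitrary map $\Phi:\mathbb{R}^n\to Y$; $\mathcal{E}(A;W;I_Q;U_e;\Phi)=\sup_{x\in W}\sup_{z\in I_Qx+U_e}\|Ax-\Phi z\|_Y$; $\mathcal{E}(A;W;I_Q;U_e)=\inf_\Phi\mathcal{E}(A;W;I_Q;U_e;\Phi)$. A method is optimal if it attains this infimum. *)

theory Defs
  imports "HOL-Analysis.Analysis"
begin

section \<open>Moduli of continuity\<close>

definition modulus_of_continuity :: "(real \<Rightarrow> real) \<Rightarrow> bool" where
  "modulus_of_continuity \<omega> \<longleftrightarrow>
     (\<forall>t\<ge>0. 0 \<le> \<omega> t) \<and> continuous_on {0..} \<omega> \<and> mono_on {0..} \<omega> \<and> \<omega> 0 = 0 \<and>
     (\<forall>s\<ge>0. \<forall>t\<ge>0. \<omega> (s + t) \<le> \<omega> s + \<omega> t)"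


section \<open>Normed lattices of measurable functions\<close>

text \<open>
  Elements of the space of measurable, almost everywhere finite functions modulo almost everywhere
  equality are represented by everywhere finite functions in \<^term>\<open>borel_measurable N\<close>. A subset
  of that space is represented by the set of all representatives of its elements, hence the
  saturation condition in \<open>normed_lattice\<close>. A norm is a function on representatives that vanishes
  exactly on the functions that are zero almost everywhere; by the triangle inequality it does not
  depend on the choice of representatives.
\<close>

definition ae_le :: "'n measure \<Rightarrow> ('n \<Rightarrow> real) \<Rightarrow> ('n \<Rightarrow> real) \<Rightarrow> bool" where
  "ae_le N x y \<longleftrightarrow> (AE s in N. x s \<le> y s)"

definition ae_eq :: "'n measure \<Rightarrow> ('n \<Rightarrow> real) \<Rightarrow> ('n \<Rightarrow> real) \<Rightarrow> bool" where
  "ae_eq N x y \<longleftrightarrow> (AE s in N. x s = y s)"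

text \<open>
  Suprema are taken in the ordered set \<open>Y\<close> itself: \<open>Y\<close> has to be a lattice for the inherited
  order, but it need not be closed under pointwise suprema. If it is, suprema in \<open>Y\<close> are the
  pointwise ones almost everywhere.
\<close>

definition is_sup_in ::
    "'n measure \<Rightarrow> ('n \<Rightarrow> real) set \<Rightarrow> ('n \<Rightarrow> real) \<Rightarrow> ('n \<Rightarrow> real) \<Rightarrow> ('n \<Rightarrow> real) \<Rightarrow> bool" where
  "is_sup_in N Y x y z \<longleftrightarrow>
     z \<in> Y \<and> ae_le N x z \<and> ae_le N y z \<and> (\<forall>w\<in>Y. ae_le N x w \<and> ae_le N y w \<longrightarrow> ae_le N z w)"

definition is_abs_in :: "'n measure \<Rightarrow> ('n \<Rightarrow> real) set \<Rightarrow> ('n \<Rightarrow> real) \<Rightarrow> ('n \<Rightarrow> real) \<Rightarrow> bool" where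
  "is_abs_in N Y x a \<longleftrightarrow> is_sup_in N Y x (\<lambda>s. - x s) a"

definition normed_lattice :: "'n measure \<Rightarrow> ('n \<Rightarrow> real) set \<Rightarrow> (('n \<Rightarrow> real) \<Rightarrow> real) \<Rightarrow> bool" where
  "normed_lattice N Y nrm \<longleftrightarrow>
     Y \<subseteq> borel_measurable N \<and>
     (\<forall>x\<in>Y. \<forall>y\<in>borel_measurable N. ae_eq N x y \<longrightarrow> y \<in> Y) \<and>
     \<comment> \<open>linear subspace\<close>
     (\<lambda>s. 0) \<in> Y \<and>
     (\<forall>x\<in>Y. \<forall>y\<in>Y. (\<lambda>s. x s + y s) \<in> Y) \<and>
     (\<forall>c. \<forall>x\<in>Y. (\<lambda>s. c * x s) \<in> Y) \<and>
     \<comment> \<open>norm\<close>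
     (\<forall>x\<in>Y. 0 \<le> nrm x) \<and>
     (\<forall>x\<in>Y. nrm x = 0 \<longleftrightarrow> ae_eq N x (\<lambda>s. 0)) \<and>
     (\<forall>x\<in>Y. \<forall>y\<in>Y. nrm (\<lambda>s. x s + y s) \<le> nrm x + nrm y) \<and>
     (\<forall>c. \<forall>x\<in>Y. nrm (\<lambda>s. c * x s) = \<bar>c\<bar> * nrm x) \<and>
     \<comment> \<open>lattice (infima are \<open>- sup (-x) (-y)\<close>) and monotonicity of the norm\<close>
     (\<forall>x\<in>Y. \<forall>y\<in>Y. \<exists>z. is_sup_in N Y x y z) \<and>
     (\<forall>x\<in>Y. \<forall>y\<in>Y. \<forall>a b. is_abs_in N Y x a \<and> is_abs_in N Y y b \<and> ae_le N a b \<longrightarrow> nrm x \<le> nrm y)"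


section \<open>Integral operators\<close>

text \<open>
  Linearity is linearity modulo almost everywhere equality. Integrability is part of the
  condition, as the Bochner integral of a non-integrable function is 0 by convention.
\<close>

definition integral_operator ::
    "'m measure \<Rightarrow> 'n measure \<Rightarrow> ('m \<Rightarrow> real) set \<Rightarrow> (('m \<Rightarrow> real) \<Rightarrow> 'n \<Rightarrow> real) \<Rightarrow>
     ('n \<Rightarrow> 'm \<Rightarrow> real) \<Rightarrow> bool" where
  "integral_operator \<mu> N E T K \<longleftrightarrow>
     T ` E \<subseteq> borel_measurable N \<and>
     (\<forall>x\<in>E. \<forall>y\<in>E. \<forall>a b. ae_eq N (T (\<lambda>t. a * x t + b * y t)) (\<lambda>s. a * T x s + b * T y s)) \<and>
     case_prod K \<in> borel_measurable (N \<Otimes>\<^sub>M \<mu>) \<and>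
     (\<forall>x\<in>E. AE s in N. integrable \<mu> (\<lambda>t. K s t * x t) \<and> T x s = (LINT t|\<mu>. K s t * x t))"


section \<open>Function classes\<close>

definition supp :: "('m::topological_space \<Rightarrow> real) \<Rightarrow> 'm set" where
  "supp x = closure {t. x t \<noteq> 0}"

definition B_class :: "'m::metric_space measure \<Rightarrow> 'm set \<Rightarrow> ('m \<Rightarrow> real) set" where
  "B_class \<mu> M' = {x \<in> borel_measurable \<mu>. (\<exists>c. AE t in \<mu>. \<bar>x t\<bar> \<le> c) \<and> supp x \<subseteq> M'}"

definition C_class :: "'m::metric_space set \<Rightarrow> ('m \<Rightarrow> real) set" where
  "C_class M' = {\<lambda>t. y t * indicator M' t | y. continuous_on UNIV y}"

definition C0_class :: "'m::metric_space set \<Rightarrow> ('m \<Rightarrow> real) set" where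
  "C0_class M' = {x. continuous_on UNIV x \<and> supp x \<subseteq> M'}"

definition H_class :: "(real \<Rightarrow> real) \<Rightarrow> 'm::metric_space set \<Rightarrow> ('m \<Rightarrow> real) set" where
  "H_class \<omega> M' = {x \<in> C_class M'. \<forall>s\<in>M'. \<forall>t\<in>M'. \<bar>x s - x t\<bar> \<le> \<omega> (dist s t)}"

definition H0_class :: "(real \<Rightarrow> real) \<Rightarrow> 'm::metric_space set \<Rightarrow> ('m \<Rightarrow> real) set" where
  "H0_class \<omega> M' = H_class \<omega> M' \<inter> C0_class M'"


section \<open>Information\<close>

text \<open>
  The index set \<open>{1, \<dots>, n}\<close>, \<open>n \<ge> 1\<close>, is rendered by a finite linearly ordered type \<open>'k\<close>; the
  order is needed for the Voronoi cells.
\<close>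

definition info :: "('k::finite \<Rightarrow> 'm) \<Rightarrow> ('m \<Rightarrow> real) \<Rightarrow> real ^ 'k" where
  "info q x = (\<chi> j. x (q j))"

definition error_box :: "real ^ 'k::finite \<Rightarrow> (real ^ 'k) set" where
  "error_box e = {u. \<forall>j. u $ j \<in> {- (e $ j)..e $ j}}"


section \<open>The functions \<open>\<tau>\<close>, Voronoi cells and the operators \<open>L\<close>\<close>

definition tau ::
    "(real \<Rightarrow> real) \<Rightarrow> 'm::metric_space set \<Rightarrow> ('k::finite \<Rightarrow> 'm) \<Rightarrow> real ^ 'k \<Rightarrow> 'm \<Rightarrow> real" where
  "tau \<omega> M' q e t = (if t \<in> M' then (MIN j. e $ j + \<omega> (dist t (q j))) else 0)"

text \<open>The case distinction is needed because \<^prop>\<open>infdist t {} = 0\<close>.\<close>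

definition boundary_modulus :: "(real \<Rightarrow> real) \<Rightarrow> 'm::metric_space set \<Rightarrow> 'm \<Rightarrow> ereal" where
  "boundary_modulus \<omega> M' t =
     (if frontier M' = {} then \<infinity> else ereal (\<omega> (infdist t (frontier M'))))"

definition tau0 ::
    "(real \<Rightarrow> real) \<Rightarrow> 'm::metric_space set \<Rightarrow> ('k::finite \<Rightarrow> 'm) \<Rightarrow> real ^ 'k \<Rightarrow> 'm \<Rightarrow> real" where
  "tau0 \<omega> M' q e t = real_of_ereal (min (ereal (tau \<omega> M' q e t)) (boundary_modulus \<omega> M' t))"

definition pre_cell ::
    "(real \<Rightarrow> real) \<Rightarrow> 'm::metric_space set \<Rightarrow> ('k::finite \<Rightarrow> 'm) \<Rightarrow> real ^ 'k \<Rightarrow> 'k \<Rightarrow> 'm set" where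
  "pre_cell \<omega> M' q e j = {t \<in> M'. tau \<omega> M' q e t = e $ j + \<omega> (dist t (q j))}"

function cell ::
    "(real \<Rightarrow> real) \<Rightarrow> 'm::metric_space set \<Rightarrow> ('k::{finite,linorder} \<Rightarrow> 'm) \<Rightarrow> real ^ 'k::{finite,linorder} \<Rightarrow>
     'k \<Rightarrow> 'm set" where
  "cell \<omega> M' q e j = pre_cell \<omega> M' q e j - (\<Union>s\<in>{..<j}. cell \<omega> M' q e s)"
  by pat_completeness auto
termination
  by (relation "Wellfounded.measure (\<lambda>(\<omega>, M', q, e, j). card {..<j})") (auto intro!: psubset_card_mono)

declare cell.simps [simp del]

definition cell0_0 ::
    "(real \<Rightarrow> real) \<Rightarrow> 'm::metric_space set \<Rightarrow> ('k::finite \<Rightarrow> 'm) \<Rightarrow> real ^ 'k \<Rightarrow> 'm set" where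
  "cell0_0 \<omega> M' q e = {t \<in> M'. boundary_modulus \<omega> M' t \<le> ereal (tau \<omega> M' q e t)}"

definition cell0 ::
    "(real \<Rightarrow> real) \<Rightarrow> 'm::metric_space set \<Rightarrow> ('k::{finite,linorder} \<Rightarrow> 'm) \<Rightarrow> real ^ 'k::{finite,linorder} \<Rightarrow>
     'k \<Rightarrow> 'm set" where
  "cell0 \<omega> M' q e j = cell \<omega> M' q e j - cell0_0 \<omega> M' q e"

text \<open>The cells are pairwise disjoint subsets of \<open>M'\<close>, so at most one summand is non-zero.\<close>

definition L_op ::
    "(real \<Rightarrow> real) \<Rightarrow> 'm::metric_space set \<Rightarrow> ('k::{finite,linorder} \<Rightarrow> 'm) \<Rightarrow> real ^ 'k::{finite,linorder} \<Rightarrow>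
     real ^ 'k::{finite,linorder} \<Rightarrow> 'm \<Rightarrow> real" where
  "L_op \<omega> M' q e z t = (\<Sum>j\<in>UNIV. z $ j * indicator (cell \<omega> M' q e j) t)"

definition L0_op ::
    "(real \<Rightarrow> real) \<Rightarrow> 'm::metric_space set \<Rightarrow> ('k::{finite,linorder} \<Rightarrow> 'm) \<Rightarrow> real ^ 'k::{finite,linorder} \<Rightarrow>
     real ^ 'k::{finite,linorder} \<Rightarrow> 'm \<Rightarrow> real" where
  "L0_op \<omega> M' q e z t = (\<Sum>j\<in>UNIV. z $ j * indicator (cell0 \<omega> M' q e j) t)"


section \<open>Optimal recovery\<close>

text \<open>Errors are extended reals because the error of a particular recovery map may be infinite.\<close>

definition recovery_error ::
    "(('n \<Rightarrow> real) \<Rightarrow> real) \<Rightarrow> (('m \<Rightarrow> real) \<Rightarrow> 'n \<Rightarrow> real) \<Rightarrow> ('m \<Rightarrow> real) set \<Rightarrow>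
     (('m \<Rightarrow> real) \<Rightarrow> real ^ 'k) \<Rightarrow> (real ^ 'k::finite) set \<Rightarrow> (real ^ 'k \<Rightarrow> 'n \<Rightarrow> real) \<Rightarrow> ereal" where
  "recovery_error nrm A W I U \<Phi> =
     (SUP x\<in>W. SUP z\<in>(\<lambda>u. I x + u) ` U. ereal (nrm (\<lambda>s. A x s - \<Phi> z s)))"

definition optimal_error ::
    "('n \<Rightarrow> real) set \<Rightarrow> (('n \<Rightarrow> real) \<Rightarrow> real) \<Rightarrow> (('m \<Rightarrow> real) \<Rightarrow> 'n \<Rightarrow> real) \<Rightarrow>
     ('m \<Rightarrow> real) set \<Rightarrow> (('m \<Rightarrow> real) \<Rightarrow> real ^ 'k) \<Rightarrow> (real ^ 'k::finite) set \<Rightarrow> ereal" where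
  "optimal_error Y nrm A W I U = (INF \<Phi>\<in>UNIV \<rightarrow> Y. recovery_error nrm A W I U \<Phi>)"

definition optimal_recovery ::
    "('n \<Rightarrow> real) set \<Rightarrow> (('n \<Rightarrow> real) \<Rightarrow> real) \<Rightarrow> (('m \<Rightarrow> real) \<Rightarrow> 'n \<Rightarrow> real) \<Rightarrow>
     ('m \<Rightarrow> real) set \<Rightarrow> (('m \<Rightarrow> real) \<Rightarrow> real ^ 'k) \<Rightarrow> (real ^ 'k::finite) set \<Rightarrow>
     (real ^ 'k \<Rightarrow> 'n \<Rightarrow> real) \<Rightarrow> bool" where
  "optimal_recovery Y nrm A W I U \<Phi> \<longleftrightarrow>
     \<Phi> \<in> UNIV \<rightarrow> Y \<and> recovery_error nrm A W I U \<Phi> = optimal_error Y nrm A W I U"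

end

theory Submission
  imports Defs
begin

text \<open>
  On each cell the method \<open>L\<close> copies the observed value at the sample point that realises the minimum
  in \<open>\<phi>\<close>, so \<open>\<bar>x - L z\<bar> \<le> \<phi>\<close> pointwise for every \<open>x\<close> in the class; near the boundary, where
  \<open>L z = 0\<close>, this holds because \<open>x\<close> vanishes on the boundary. Positivity of the kernel and monotonicity
  of the norm turn this into the upper bound. Conversely, \<open>\<phi>\<close> itself belongs to the class and
  \<open>\<bar>\<phi> (q j)\<bar> \<le> e j\<close>, so \<open>\<phi>\<close> and \<open>-\<phi>\<close> cannot be told apart from the data \<open>0\<close>, which gives the lower
  bound.
\<close>

section \<open>Normed lattices\<close>

lemma normed_latticeD:
  assumes "normed_lattice N Y nrm"
  shows "Y \<subseteq> borel_measurable N"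
    and "\<And>x y. x \<in> Y \<Longrightarrow> y \<in> borel_measurable N \<Longrightarrow> ae_eq N x y \<Longrightarrow> y \<in> Y"
    and "\<And>x y. x \<in> Y \<Longrightarrow> y \<in> Y \<Longrightarrow> (\<lambda>s. x s + y s) \<in> Y"
    and "\<And>c x. x \<in> Y \<Longrightarrow> (\<lambda>s. c * x s) \<in> Y"
    and "\<And>x. x \<in> Y \<Longrightarrow> nrm x = 0 \<longleftrightarrow> ae_eq N x (\<lambda>s. 0)"
    and "\<And>x y. x \<in> Y \<Longrightarrow> y \<in> Y \<Longrightarrow> nrm (\<lambda>s. x s + y s) \<le> nrm x + nrm y"
    and "\<And>c x. x \<in> Y \<Longrightarrow> nrm (\<lambda>s. c * x s) = \<bar>c\<bar> * nrm x"
    and "\<And>x y. x \<in> Y \<Longrightarrow> y \<in> Y \<Longrightarrow> \<exists>z. is_sup_in N Y x y z"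
    and "\<And>x y a b. x \<in> Y \<Longrightarrow> y \<in> Y \<Longrightarrow> is_abs_in N Y x a \<Longrightarrow> is_abs_in N Y y b \<Longrightarrow> ae_le N a b \<Longrightarrow>
      nrm x \<le> nrm y"
  using assms unfolding normed_lattice_def by (elim conjE; blast)+

lemma normed_lattice_uminus:
  assumes "normed_lattice N Y nrm" "x \<in> Y"
  shows "(\<lambda>s. - x s) \<in> Y" "nrm (\<lambda>s. - x s) = nrm x"
  using normed_latticeD(4,7)[OF assms(1) assms(2), of "- 1"] by simp_all

lemma normed_lattice_minus:
  assumes nl: "normed_lattice N Y nrm" and x: "x \<in> Y" and y: "y \<in> Y"
  shows "(\<lambda>s. x s - y s) \<in> Y" "nrm (\<lambda>s. x s - y s) \<le> nrm x + nrm y"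
  using normed_latticeD(3,6)[OF nl x normed_lattice_uminus(1)[OF nl y]]
    normed_lattice_uminus(2)[OF nl y] by simp_all

text \<open>The difference of the two functions has norm 0, so the triangle inequality bounds each
  norm by the other. This is needed because the kernel formula determines the values of an integral
  operator only almost everywhere.\<close>

lemma normed_lattice_norm_cong:
  assumes nl: "normed_lattice N Y nrm" and x: "x \<in> Y" and y: "y \<in> Y" and eq: "ae_eq N x y"
  shows "nrm x = nrm y"
proof -
  have le: "nrm u \<le> nrm v" if u: "u \<in> Y" and v: "v \<in> Y" and uv: "ae_eq N u v" for u v
  proof -
    have d: "(\<lambda>s. u s - v s) \<in> Y"
      using normed_lattice_minus(1)[OF nl u v] .
    have "ae_eq N (\<lambda>s. u s - v s) (\<lambda>s. 0)"
      using uv unfolding ae_eq_def by simp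
    then have "nrm (\<lambda>s. u s - v s) = 0"
      using normed_latticeD(5)[OF nl d] by simp
    moreover have "nrm (\<lambda>s. v s + (u s - v s)) \<le> nrm v + nrm (\<lambda>s. u s - v s)"
      using normed_latticeD(6)[OF nl v d] .
    ultimately show ?thesis by simp
  qed
  have "ae_eq N y x" using eq unfolding ae_eq_def by (simp add: eq_commute)
  then show ?thesis using le[OF x y eq] le[OF y x] by simp
qed

text \<open>The modulus of \<open>x\<close> in \<open>Y\<close> is a least upper bound in \<open>Y\<close>, so it lies below the dominating
  function even where it differs from the pointwise modulus.\<close>

lemma normed_lattice_norm_mono:
  assumes nl: "normed_lattice N Y nrm" and x: "x \<in> Y" and y: "y \<in> Y"
    and le: "AE s in N. \<bar>x s\<bar> \<le> y s"
  shows "nrm x \<le> nrm y"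
proof -
  obtain a where a: "is_sup_in N Y x (\<lambda>s. - x s) a"
    using normed_latticeD(8)[OF nl x normed_lattice_uminus(1)[OF nl x]] by blast
  have "ae_le N x y" "ae_le N (\<lambda>s. - x s) y"
    using le by (auto simp: ae_le_def elim!: eventually_mono)
  then have ay: "ae_le N a y"
    using a y unfolding is_sup_in_def by blast
  \<comment> \<open>The hypothesis forces \<open>y\<close> to be nonnegative almost everywhere, so
    \<open>y\<close> is its own modulus in \<open>Y\<close>.\<close>
  have "ae_le N (\<lambda>s. - y s) y"
    using le by (auto simp: ae_le_def elim!: eventually_mono)
  then have "is_abs_in N Y y y"
    using y by (simp add: is_abs_in_def is_sup_in_def ae_le_def)
  then show ?thesis
    using normed_latticeD(9)[OF nl x y _ _ ay] a by (simp add: is_abs_in_def)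
qed


section \<open>Optimality from an extremal function\<close>

lemma integral_operatorD:
  assumes "integral_operator \<mu> N E T K" and "x \<in> E"
  shows "AE s in N. integrable \<mu> (\<lambda>t. K s t * x t) \<and> T x s = (LINT t|\<mu>. K s t * x t)"
  using assms unfolding integral_operator_def by blast

text \<open>By Fubini for null sets, almost every section \<open>K s\<close> is nonnegative almost
  everywhere. For such \<open>s\<close>, outside the null sets where one of the three kernel
  formulas fails, the difference is at most the integral of
  \<open>K s t * \<bar>x t - y t\<bar>\<close>, hence of \<open>K s t * \<phi> t\<close>.\<close>

lemma integral_operator_dominated:
  assumes \<mu>: "sigma_finite_measure \<mu>" and N: "sigma_finite_measure N"
    and T: "integral_operator \<mu> N E T K"
    and K: "AE (s, t) in N \<Otimes>\<^sub>M \<mu>. 0 \<le> K s t"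
    and x: "x \<in> E" and y: "y \<in> E" and \<phi>: "\<phi> \<in> E"
    and le: "\<And>t. \<bar>x t - y t\<bar> \<le> \<phi> t"
  shows "AE s in N. \<bar>T x s - T y s\<bar> \<le> T \<phi> s"
proof -
  interpret pair_sigma_finite N \<mu>
    using \<mu> N by (simp add: pair_sigma_finite_def)
  have "AE s in N. AE t in \<mu>. 0 \<le> K s t"
    using AE_pair[OF K] by simp
  then show ?thesis
    using integral_operatorD[OF T x] integral_operatorD[OF T y] integral_operatorD[OF T \<phi>]
  proof eventually_elim
    case (elim s)
    have "T x s - T y s = (LINT t|\<mu>. K s t * x t - K s t * y t)"
      using elim by simp
    moreover have "\<bar>\<dots>\<bar> \<le> (LINT t|\<mu>. K s t * \<phi> t)"
    proof -
      have "AE t in \<mu>. \<bar>K s t * x t - K s t * y t\<bar> \<le> K s t * \<phi> t"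
        using elim(1)
      proof eventually_elim
        case (elim t)
        then show ?case
          using mult_left_mono[OF le[of t] elim] by (simp add: abs_mult flip: right_diff_distrib)
      qed
      then have "(LINT t|\<mu>. \<bar>K s t * x t - K s t * y t\<bar>) \<le> (LINT t|\<mu>. K s t * \<phi> t)"
        using elim by (intro integral_mono_AE) auto
      with integral_norm_bound[of \<mu> "\<lambda>t. K s t * x t - K s t * y t"]
      show ?thesis unfolding real_norm_def by (rule order_trans)
    qed
    ultimately show ?case using elim by simp
  qed
qed

lemma integral_operator_uminus:
  assumes T: "integral_operator \<mu> N E T K" and x: "x \<in> E" and mx: "(\<lambda>t. - x t) \<in> E"
  shows "AE s in N. T (\<lambda>t. - x t) s = - T x s"
  using integral_operatorD[OF T x] integral_operatorD[OF T mx]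
  by eventually_elim simp

text \<open>Separates the order argument from the geometry: the two cases of the theorem differ only
  in how these pointwise hypotheses on \<open>W\<close>, \<open>\<phi>\<close> and \<open>L\<close>
  are verified.\<close>

lemma optimal_recovery_extremal:
  assumes \<mu>: "sigma_finite_measure \<mu>" and N: "sigma_finite_measure N"
    and T: "integral_operator \<mu> N E T K"
    and K: "AE (s, t) in N \<Otimes>\<^sub>M \<mu>. 0 \<le> K s t"
    and nl: "normed_lattice N Y nrm" and TY: "T ` E \<subseteq> Y"
    and WE: "W \<subseteq> E" and LE: "\<And>z. L z \<in> E"
    and \<phi>: "\<phi> \<in> W" "(\<lambda>t. - \<phi> t) \<in> W"
    and \<phi>q: "\<And>j. \<bar>\<phi> (q j)\<bar> \<le> e $ j"
    and le: "\<And>x u t. x \<in> W \<Longrightarrow> u \<in> error_box e \<Longrightarrow> \<bar>x t - L (info q x + u) t\<bar> \<le> \<phi> t"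
  shows "optimal_recovery Y nrm T W (info q) (error_box e) (\<lambda>z. T (L z))" (is ?opt)
    and "recovery_error nrm T W (info q) (error_box e) (\<lambda>z. T (L z)) = ereal (nrm (T \<phi>))" (is ?err)
proof -
  let ?R = "recovery_error nrm T W (info q) (error_box e)"
  have TY': "T x \<in> Y" if "x \<in> E" for x using TY that by auto
  have \<phi>E: "\<phi> \<in> E" "(\<lambda>t. - \<phi> t) \<in> E" using \<phi> WE by auto
  have upper: "?R (\<lambda>z. T (L z)) \<le> ereal (nrm (T \<phi>))"
    unfolding recovery_error_def
  proof (intro SUP_least)
    fix x z assume x: "x \<in> W" and z: "z \<in> (\<lambda>u. info q x + u) ` error_box e"
    then obtain u where u: "u \<in> error_box e" "z = info q x + u" by auto
    have xE: "x \<in> E" using x WE by auto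
    have "AE s in N. \<bar>T x s - T (L z) s\<bar> \<le> T \<phi> s"
      using integral_operator_dominated[OF \<mu> N T K xE LE \<phi>E(1)] le[OF x u(1)] u(2) by blast
    then have "nrm (\<lambda>s. T x s - T (L z) s) \<le> nrm (T \<phi>)"
      by (intro normed_lattice_norm_mono[OF nl] normed_lattice_minus(1)[OF nl] TY' xE LE \<phi>E)
    then show "ereal (nrm (\<lambda>s. T x s - T (L z) s)) \<le> ereal (nrm (T \<phi>))" by simp
  qed
  have lower: "ereal (nrm (T \<phi>)) \<le> ?R \<Phi>" if \<Phi>: "\<Phi> \<in> UNIV \<rightarrow> Y" for \<Phi>
  proof -
    define y where "y = \<Phi> 0"
    have y: "y \<in> Y" using \<Phi> by (auto simp: y_def)
    \<comment> \<open>The error \<open>- info q x\<close> cancels the exact data; it lies in the box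
      by \<open>\<phi>q\<close>, for either sign of \<open>\<phi>\<close>.\<close>
    have zero: "0 \<in> (\<lambda>u. info q x + u) ` error_box e" if "x = \<phi> \<or> x = (\<lambda>t. - \<phi> t)" for x
    proof
      show "0 = info q x + - info q x" by simp
      show "- info q x \<in> error_box e"
        using that \<phi>q by (auto simp: error_box_def info_def abs_le_iff minus_le_iff)
    qed
    have R: "ereal (nrm (\<lambda>s. T x s - y s)) \<le> ?R \<Phi>" if "x = \<phi> \<or> x = (\<lambda>t. - \<phi> t)" for x
    proof -
      have x: "x \<in> W" using that \<phi> by auto
      show ?thesis
        unfolding recovery_error_def y_def
        by (rule SUP_upper2[OF x], rule SUP_upper2[OF zero[OF that]]) simp
    qed
    \<comment> \<open>Errors at \<open>\<phi>\<close> and \<open>-\<phi>\<close> for the single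
      guess \<open>y\<close>. Subtracting them cancels \<open>y\<close> and leaves
      \<open>2 * T \<phi>\<close> almost everywhere, so one of the two norms is at least
      \<open>nrm (T \<phi>)\<close>.\<close>
    define a where "a = (\<lambda>s. T \<phi> s - y s)"
    define b where "b = (\<lambda>s. T (\<lambda>t. - \<phi> t) s - y s)"
    have aY: "a \<in> Y" and bY: "b \<in> Y"
      unfolding a_def b_def by (intro normed_lattice_minus(1)[OF nl] TY' \<phi>E y)+
    have "ae_eq N (\<lambda>s. 2 * T \<phi> s) (\<lambda>s. a s - b s)"
      using integral_operator_uminus[OF T \<phi>E] unfolding ae_eq_def a_def b_def
      by eventually_elim simp
    moreover have "(\<lambda>s. 2 * T \<phi> s) \<in> Y" and two: "nrm (\<lambda>s. 2 * T \<phi> s) = \<bar>2\<bar> * nrm (T \<phi>)"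
      using normed_latticeD(4,7)[OF nl TY'[OF \<phi>E(1)]] by blast+
    ultimately have "nrm (\<lambda>s. 2 * T \<phi> s) = nrm (\<lambda>s. a s - b s)"
      by (intro normed_lattice_norm_cong[OF nl] normed_lattice_minus(1)[OF nl] aY bY)
    then have "2 * nrm (T \<phi>) \<le> nrm a + nrm b"
      using two normed_lattice_minus(2)[OF nl aY bY] by simp
    then have "nrm (T \<phi>) \<le> nrm a \<or> nrm (T \<phi>) \<le> nrm b" by linarith
    moreover have "ereal (nrm a) \<le> ?R \<Phi>" "ereal (nrm b) \<le> ?R \<Phi>"
      unfolding a_def b_def by (intro R; simp)+
    ultimately show ?thesis by (meson ereal_less_eq(3) order_trans)
  qed
  \<comment> \<open>The lower bound holds for every \<open>Y\<close>-valued map, hence for the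
    method itself; with \<open>upper\<close> it fixes both the error of the method and the
    infimum.\<close>
  have \<Phi>: "(\<lambda>z. T (L z)) \<in> UNIV \<rightarrow> Y" using TY' LE by auto
  show err: ?err using upper lower[OF \<Phi>] by (rule antisym)
  have "optimal_error Y nrm T W (info q) (error_box e) = ereal (nrm (T \<phi>))"
    unfolding optimal_error_def
  proof (rule antisym)
    show "(INF \<Phi>\<in>UNIV \<rightarrow> Y. ?R \<Phi>) \<le> ereal (nrm (T \<phi>))"
      using INF_lower2[of _ "UNIV \<rightarrow> Y" ?R, OF \<Phi> upper] .
    show "ereal (nrm (T \<phi>)) \<le> (INF \<Phi>\<in>UNIV \<rightarrow> Y. ?R \<Phi>)"
      by (intro INF_greatest lower)
  qed
  then show ?opt using err \<Phi> by (simp add: optimal_recovery_def)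
qed


section \<open>Moduli of continuity\<close>

lemma modulus_of_continuity_nonneg: "modulus_of_continuity \<omega> \<Longrightarrow> 0 \<le> t \<Longrightarrow> 0 \<le> \<omega> t"
  by (simp add: modulus_of_continuity_def)

text \<open>Monotonicity gives \<open>\<omega> a \<le> \<omega> (b + c)\<close>, subadditivity
  splits the right side, and the roles of \<open>a\<close> and \<open>b\<close> are
  symmetric.\<close>

lemma modulus_of_continuity_diff_le:
  assumes \<omega>: "modulus_of_continuity \<omega>" and ab: "0 \<le> a" "0 \<le> b" and c: "\<bar>a - b\<bar> \<le> c"
  shows "\<bar>\<omega> a - \<omega> b\<bar> \<le> \<omega> c"
proof -
  have mono: "\<omega> s \<le> \<omega> t" if "0 \<le> s" "s \<le> t" for s t
    using \<omega> that unfolding modulus_of_continuity_def mono_on_def by auto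
  have sub: "\<omega> (s + t) \<le> \<omega> s + \<omega> t" if "0 \<le> s" "0 \<le> t" for s t
    using \<omega> that unfolding modulus_of_continuity_def by auto
  have "\<omega> a \<le> \<omega> (b + c)" "\<omega> b \<le> \<omega> (a + c)" using ab c by (auto intro!: mono)
  moreover have "\<omega> (b + c) \<le> \<omega> b + \<omega> c" "\<omega> (a + c) \<le> \<omega> a + \<omega> c"
    using ab c by (auto intro!: sub)
  ultimately show ?thesis by linarith
qed

lemma continuous_on_modulus_of_continuity:
  assumes "modulus_of_continuity \<omega>" "continuous_on S f" "\<And>t. t \<in> S \<Longrightarrow> 0 \<le> f t"
  shows "continuous_on S (\<lambda>t. \<omega> (f t))"
proof (rule continuous_on_compose2[OF _ assms(2)])
  show "continuous_on {0..} \<omega>" using assms(1) by (simp add: modulus_of_continuity_def)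
  show "f ` S \<subseteq> {0..}" using assms(3) by auto
qed

lemma continuous_on_MIN:
  fixes f :: "'k::finite \<Rightarrow> 'a::topological_space \<Rightarrow> real"
  assumes "\<And>j. continuous_on S (f j)"
  shows "continuous_on S (\<lambda>t. MIN j. f j t)"
proof -
  have "continuous_on S (\<lambda>t. Min ((\<lambda>j. f j t) ` J))" if "finite J" "J \<noteq> {}" for J :: "'k set"
    using that
  proof (induction J rule: finite_ne_induct)
    case (singleton j)
    show ?case by (simp add: assms)
  next
    case (insert j J)
    have "Min ((\<lambda>i. f i t) ` insert j J) = min (f j t) (Min ((\<lambda>i. f i t) ` J))" for t
      using insert.hyps by simp
    then show ?case by (simp only:) (intro continuous_on_min assms insert.IH)
  qed
  then show ?thesis by simp
qed

text \<open>Each minimum is compared with the value of its function at the minimiser of the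
  other.\<close>

lemma MIN_diff_le:
  fixes f g :: "'k::finite \<Rightarrow> real"
  assumes "\<And>j. \<bar>f j - g j\<bar> \<le> c"
  shows "\<bar>(MIN j. f j) - (MIN j. g j)\<bar> \<le> c"
proof -
  have "(MIN j. f j) \<in> range f" "(MIN j. g j) \<in> range g" by (rule Min_in; simp)+
  then obtain i k where i: "(MIN j. f j) = f i" and k: "(MIN j. g j) = g k" by blast
  have "(MIN j. f j) \<le> f k" "(MIN j. g j) \<le> g i" by auto
  then show ?thesis using i k assms[of i] assms[of k] by linarith
qed


section \<open>Function classes\<close>

text \<open>A closed set containing the nonzero points also contains their closure, so the support
  condition becomes plain vanishing off \<open>M'\<close>.\<close>

lemma supp_subset_iff: "closed M' \<Longrightarrow> supp x \<subseteq> M' \<longleftrightarrow> (\<forall>t. t \<notin> M' \<longrightarrow> x t = 0)"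
  unfolding supp_def using closure_minimal[of "{t. x t \<noteq> 0}" M'] closure_subset[of "{t. x t \<noteq> 0}"] by auto

lemma B_classI:
  assumes "sets \<mu> = sets borel" "closed M'" "x \<in> borel_measurable borel"
    "\<And>t. \<bar>x t\<bar> \<le> c" "\<And>t. t \<notin> M' \<Longrightarrow> x t = 0"
  shows "x \<in> B_class \<mu> M'"
  using assms by (auto simp: B_class_def supp_subset_iff cong: measurable_cong_sets)

lemma C_class_subset_B_class:
  assumes \<mu>: "sets \<mu> = sets borel" and M': "compact M'"
  shows "C_class M' \<subseteq> B_class \<mu> M'"
proof
  fix x assume "x \<in> C_class M'"
  then obtain y where x: "x = (\<lambda>t. y t * indicator M' t)" and y: "continuous_on UNIV y"
    by (auto simp: C_class_def)
  have "compact (y ` M')"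
    using y M' by (intro compact_continuous_image) (auto intro: continuous_on_subset)
  then obtain c where c: "\<forall>v\<in>y ` M'. norm v \<le> c"
    using compact_imp_bounded bounded_iff by blast
  have cl: "closed M'" using M' by (rule compact_imp_closed)
  show "x \<in> B_class \<mu> M'"
  proof (rule B_classI[OF \<mu> cl])
    show "x \<in> borel_measurable borel"
      unfolding x using y cl
      by (intro borel_measurable_times borel_measurable_continuous_onI borel_measurable_indicator) auto
    \<comment> \<open>The value is 0 off \<open>M'\<close>, and \<open>c\<close> may be negative
      when \<open>M'\<close> is empty; hence the maximum with 0.\<close>
    show "\<bar>x t\<bar> \<le> max 0 c" for t
      using c by (auto simp: x indicator_def)
    show "x t = 0" if "t \<notin> M'" for t using that by (simp add: x)
  qed
qed

lemma C_class_outside: "x \<in> C_class M' \<Longrightarrow> t \<notin> M' \<Longrightarrow> x t = 0"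
  by (auto simp: C_class_def)

lemma H_class_uminus:
  assumes "x \<in> H_class \<omega> M'"
  shows "(\<lambda>t. - x t) \<in> H_class \<omega> M'"
proof -
  obtain y where "x = (\<lambda>t. y t * indicator M' t)" "continuous_on UNIV y"
    using assms by (auto simp: H_class_def C_class_def)
  then have "(\<lambda>t. - x t) \<in> C_class M'"
    unfolding C_class_def by (intro CollectI exI[of _ "\<lambda>t. - y t"]) (auto intro: continuous_on_minus)
  moreover have "\<bar>- x s - - x t\<bar> \<le> \<omega> (dist s t)" if "s \<in> M'" "t \<in> M'" for s t
    using assms that by (simp add: H_class_def abs_minus_commute)
  ultimately show ?thesis by (auto simp: H_class_def)
qed

lemma H0_class_uminus: "x \<in> H0_class \<omega> M' \<Longrightarrow> (\<lambda>t. - x t) \<in> H0_class \<omega> M'"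
  by (auto simp: H0_class_def C0_class_def supp_def intro: H_class_uminus continuous_on_minus)

text \<open>The function is continuous on the whole space and zero on the complement of
  \<open>M'\<close>, hence zero on the closure of that complement, which contains the
  frontier.\<close>

lemma H0_class_frontier:
  assumes x: "x \<in> H0_class \<omega> M'" and M': "closed M'" and t: "t \<in> frontier M'"
  shows "x t = 0"
proof -
  have cont: "continuous_on UNIV x" and out: "\<And>s. s \<in> - M' \<Longrightarrow> x s = 0"
    using x M' by (auto simp: H0_class_def C0_class_def supp_subset_iff)
  have "t \<in> closure (- M')" using t by (simp add: frontier_closures)
  then show ?thesis
    using continuous_constant_on_closure[of "- M'" x 0 t] cont out
    by (auto intro: continuous_on_subset)
qed

text \<open>The frontier is compact, so \<open>t\<close> has a nearest frontier point
  \<open>s\<close>. It lies in \<open>M'\<close> and \<open>x s = 0\<close>, so the modulus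
  condition for the pair \<open>t\<close>, \<open>s\<close> is the claim. With empty frontier the
  bound is infinite.\<close>

lemma H0_class_le_boundary_modulus:
  assumes x: "x \<in> H0_class \<omega> M'" and M': "compact M'" and t: "t \<in> M'"
  shows "ereal \<bar>x t\<bar> \<le> boundary_modulus \<omega> M' t"
proof (cases "frontier M' = {}")
  case False
  have "compact (frontier M')"
    using compact_Int_closed[OF M' frontier_closed[of M']] frontier_subset_closed[OF compact_imp_closed[OF M']]
    by (simp add: inf.absorb2)
  then obtain s where s: "s \<in> frontier M'" "infdist t (frontier M') = dist t s"
    using setdist_attains_inf[OF _ False, of "{t}"] by (auto simp: infdist_eq_setdist[of t] infdist_singleton dist_commute)
  have "s \<in> M'" using s(1) frontier_subset_closed[OF compact_imp_closed[OF M']] by blast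
  then have "\<bar>x t - x s\<bar> \<le> \<omega> (dist t s)"
    using x t by (auto simp: H0_class_def H_class_def)
  then show ?thesis
    using s H0_class_frontier[OF x compact_imp_closed[OF M'] s(1)] False by (simp add: boundary_modulus_def)
qed (simp add: boundary_modulus_def)


section \<open>The extremal functions\<close>

lemma tau_nonneg:
  assumes "modulus_of_continuity \<omega>" "\<forall>j. 0 \<le> e $ j"
  shows "0 \<le> tau \<omega> M' q e t"
  using assms by (auto simp: tau_def modulus_of_continuity_nonneg)

lemma tau_le: "t \<in> M' \<Longrightarrow> tau \<omega> M' q e t \<le> e $ j + \<omega> (dist t (q j))"
  by (auto simp: tau_def intro: Min_le)

lemma tau_outside: "t \<notin> M' \<Longrightarrow> tau \<omega> M' q e t = 0"
  by (simp add: tau_def)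

lemma continuous_on_MIN_modulus:
  assumes "modulus_of_continuity \<omega>"
  shows "continuous_on S (\<lambda>t. MIN j. e $ j + \<omega> (dist t (q j)))"
  by (intro continuous_on_MIN continuous_intros continuous_on_modulus_of_continuity[OF assms]) auto

text \<open>Each term \<open>e $ j + \<omega> (dist t (q j))\<close> has modulus of continuity
  \<open>\<omega>\<close> because the distance to \<open>q j\<close> is 1-Lipschitz, and finite
  minima preserve this.\<close>

lemma tau_diff_le:
  assumes \<omega>: "modulus_of_continuity \<omega>" and "s \<in> M'" "t \<in> M'"
  shows "\<bar>tau \<omega> M' q e s - tau \<omega> M' q e t\<bar> \<le> \<omega> (dist s t)"
proof -
  have "\<bar>(e $ j + \<omega> (dist s (q j))) - (e $ j + \<omega> (dist t (q j)))\<bar> \<le> \<omega> (dist s t)" for j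
  proof -
    have "\<bar>dist s (q j) - dist t (q j)\<bar> \<le> dist s t"
      using dist_triangle[of s "q j" t] dist_triangle[of t "q j" s] by (simp add: dist_commute abs_le_iff)
    then have "\<bar>\<omega> (dist s (q j)) - \<omega> (dist t (q j))\<bar> \<le> \<omega> (dist s t)"
      by (intro modulus_of_continuity_diff_le[OF \<omega>]) auto
    then show ?thesis by simp
  qed
  then show ?thesis using assms by (simp add: tau_def MIN_diff_le)
qed

lemma tau_in_H_class:
  assumes \<omega>: "modulus_of_continuity \<omega>"
  shows "tau \<omega> M' q e \<in> H_class \<omega> M'"
proof -
  have "tau \<omega> M' q e = (\<lambda>t. (MIN j. e $ j + \<omega> (dist t (q j))) * indicator M' t)"
    by (auto simp: tau_def fun_eq_iff)
  then have "tau \<omega> M' q e \<in> C_class M'"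
    using continuous_on_MIN_modulus[OF \<omega>, of UNIV e q] unfolding C_class_def
    by (intro CollectI exI[of _ "\<lambda>t. MIN j. e $ j + \<omega> (dist t (q j))"] conjI)
  then show ?thesis by (simp add: H_class_def tau_diff_le[OF \<omega>])
qed

text \<open>Eliminates the extended reals: with empty frontier the infinite term drops out of the
  minimum, otherwise all terms are finite.\<close>

lemma tau0_eq:
  "tau0 \<omega> M' q e t = (if frontier M' = {} then tau \<omega> M' q e t
     else min (tau \<omega> M' q e t) (\<omega> (infdist t (frontier M'))))"
  by (simp add: tau0_def boundary_modulus_def flip: ereal_min)

lemma tau0_nonneg:
  assumes "modulus_of_continuity \<omega>" "\<forall>j. 0 \<le> e $ j"
  shows "0 \<le> tau0 \<omega> M' q e t"
  using tau_nonneg[OF assms, of M' q t]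
    modulus_of_continuity_nonneg[OF assms(1) infdist_nonneg, of t "frontier M'"]
  by (simp add: tau0_eq)

lemma tau0_le_tau: "tau0 \<omega> M' q e t \<le> tau \<omega> M' q e t"
  by (simp add: tau0_eq)

lemma tau0_outside:
  assumes "modulus_of_continuity \<omega>" "t \<notin> M'"
  shows "tau0 \<omega> M' q e t = 0"
  using assms modulus_of_continuity_nonneg[OF assms(1) infdist_nonneg, of t "frontier M'"]
  by (simp add: tau0_eq tau_outside)

lemma tau0_frontier:
  assumes "modulus_of_continuity \<omega>" "\<forall>j. 0 \<le> e $ j" "t \<in> frontier M'"
  shows "tau0 \<omega> M' q e t = 0"
  using assms tau_nonneg[OF assms(1,2), of M' q t]
  by (auto simp: tau0_eq modulus_of_continuity_def)

text \<open>\<open>tau\<close> may jump across the frontier, but \<open>tau0\<close> vanishes there.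
  So two continuous pieces on the closed sets \<open>M'\<close> and \<open>closure (- M')\<close>
  are glued, the second being constantly 0.\<close>

lemma continuous_on_tau0:
  assumes \<omega>: "modulus_of_continuity \<omega>" and e: "\<forall>j. 0 \<le> e $ j" and M': "closed M'"
  shows "continuous_on UNIV (tau0 \<omega> M' q e)"
proof -
  have "continuous_on M' (tau \<omega> M' q e)"
    using continuous_on_MIN_modulus[OF \<omega>, of M'] by (rule continuous_on_eq) (simp add: tau_def)
  then have "continuous_on M' (tau0 \<omega> M' q e)"
    unfolding tau0_eq
    by (cases "frontier M' = {}") (simp_all add: continuous_on_min infdist_nonneg
        continuous_on_modulus_of_continuity[OF \<omega>] continuous_on_infdist continuous_on_id)
  moreover have "continuous_on (closure (- M')) (tau0 \<omega> M' q e)"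
  proof (rule continuous_on_eq[OF continuous_on_const])
    fix t assume "t \<in> closure (- M')"
    then have "t \<in> frontier M' \<or> t \<notin> M'"
      using M' by (auto simp: frontier_closures)
    then show "0 = tau0 \<omega> M' q e t"
      by (auto simp: tau0_frontier[OF \<omega> e] tau0_outside[OF \<omega>])
  qed
  moreover have "M' \<union> closure (- M') = UNIV" using closure_subset[of "- M'"] by auto
  ultimately show ?thesis
    using continuous_on_closed_Un[OF M' closed_closure[of "- M'"], of "tau0 \<omega> M' q e"] by simp
qed

lemma tau0_in_H0_class:
  assumes \<omega>: "modulus_of_continuity \<omega>" and e: "\<forall>j. 0 \<le> e $ j" and M': "closed M'"
  shows "tau0 \<omega> M' q e \<in> H0_class \<omega> M'"
proof -
  note cont = continuous_on_tau0[OF assms, of q]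
  have "tau0 \<omega> M' q e = (\<lambda>t. tau0 \<omega> M' q e t * indicator M' t)"
    by (auto simp: fun_eq_iff tau0_outside[OF \<omega>] indicator_def)
  then have "tau0 \<omega> M' q e \<in> C_class M'"
    unfolding C_class_def using cont by (intro CollectI exI[of _ "tau0 \<omega> M' q e"] conjI)
  moreover have "tau0 \<omega> M' q e \<in> C0_class M'"
    using cont by (simp add: C0_class_def supp_subset_iff[OF M'] tau0_outside[OF \<omega>])
  moreover have "\<bar>tau0 \<omega> M' q e s - tau0 \<omega> M' q e t\<bar> \<le> \<omega> (dist s t)" if "s \<in> M'" "t \<in> M'" for s t
  proof -
    \<comment> \<open>The distance to the frontier is 1-Lipschitz, so both terms of the minimum
      defining \<open>tau0\<close> have modulus \<open>\<omega>\<close>.\<close>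
    have "\<bar>\<omega> (infdist s (frontier M')) - \<omega> (infdist t (frontier M'))\<bar> \<le> \<omega> (dist s t)"
      by (intro modulus_of_continuity_diff_le[OF \<omega>] infdist_nonneg infdist_triangle_abs)
    then show ?thesis
      using tau_diff_le[OF \<omega> that, of q e] by (auto simp: tau0_eq)
  qed
  ultimately show ?thesis by (simp add: H0_class_def H_class_def)
qed


section \<open>Voronoi cells\<close>

text \<open>A point of an earlier pre-cell lies in the cell of that index or in a still earlier
  cell, so removing earlier pre-cells removes the same points. The non-recursive form makes
  disjointness and measurability direct.\<close>

lemma cell_eq: "cell \<omega> M' q e j = pre_cell \<omega> M' q e j - (\<Union>s\<in>{..<j}. pre_cell \<omega> M' q e s)"
proof -
  let ?c = "cell \<omega> M' q e" and ?p = "pre_cell \<omega> M' q e"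
  have rec: "?c s = ?p s - (\<Union>r\<in>{..<s}. ?c r)" for s by (rule cell.simps)
  have "(\<Union>s\<in>{..<j}. ?p s) = (\<Union>s\<in>{..<j}. ?c s)"
  proof (intro equalityI subsetI)
    fix t assume "t \<in> (\<Union>s\<in>{..<j}. ?p s)"
    then obtain s where s: "s < j" "t \<in> ?p s" by blast
    show "t \<in> (\<Union>s\<in>{..<j}. ?c s)"
    proof (cases "t \<in> ?c s")
      case True
      then show ?thesis using s by blast
    next
      case False
      then obtain r where "r < s" "t \<in> ?c r" using s(2) rec[of s] by blast
      then show ?thesis using s(1) by (meson UN_I lessThan_iff less_trans)
    qed
  next
    fix t assume "t \<in> (\<Union>s\<in>{..<j}. ?c s)"
    then obtain s where s: "s < j" "t \<in> ?c s" by blast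
    then have "t \<in> ?p s" using rec[of s] by blast
    then show "t \<in> (\<Union>s\<in>{..<j}. ?p s)" using s(1) by blast
  qed
  then show ?thesis using rec[of j] by simp
qed

lemma cell_disjoint: "t \<in> cell \<omega> M' q e i \<Longrightarrow> t \<in> cell \<omega> M' q e j \<Longrightarrow> i = j"
  by (cases i j rule: linorder_cases) (auto simp: cell_eq)

lemma cell_cover:
  assumes "t \<in> M'"
  obtains j where "t \<in> cell \<omega> M' q e j"
proof -
  let ?f = "\<lambda>j. e $ j + \<omega> (dist t (q j))"
  have "(MIN j. ?f j) \<in> range ?f" by (rule Min_in) simp_all
  then obtain i where "(MIN j. ?f j) = ?f i" by (rule rangeE)
  then have "t \<in> pre_cell \<omega> M' q e i"
    using assms by (simp add: pre_cell_def tau_def)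
  \<comment> \<open>The cell containing \<open>t\<close> is that of the least index attaining the
    minimum.\<close>
  define J where "J = {j. t \<in> pre_cell \<omega> M' q e j}"
  define j where "j = Min J"
  have "J \<noteq> {}" using \<open>t \<in> pre_cell \<omega> M' q e i\<close> by (auto simp: J_def)
  then have "j \<in> J" unfolding j_def by (intro Min_in finite)
  moreover have "j \<le> s" if "s \<in> J" for s
    unfolding j_def using that by (intro Min_le finite)
  ultimately have "t \<in> pre_cell \<omega> M' q e j" "\<And>s. s < j \<Longrightarrow> t \<notin> pre_cell \<omega> M' q e s"
    unfolding J_def by (auto simp flip: not_le)
  then have "t \<in> cell \<omega> M' q e j" by (simp add: cell_eq)
  then show ?thesis by (rule that)
qed

lemma L_op_cell:
  assumes t: "t \<in> cell \<omega> M' q e j"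
  shows "L_op \<omega> M' q e z t = z $ j"
proof -
  have "z $ i * indicator (cell \<omega> M' q e i) t = (if i = j then z $ i else 0)" for i
  proof (cases "i = j")
    case False
    then have "t \<notin> cell \<omega> M' q e i" using cell_disjoint[OF t] by blast
    then show ?thesis using False by simp
  qed (simp add: t)
  then show ?thesis by (simp add: L_op_def)
qed

lemma L_op_outside: "t \<notin> M' \<Longrightarrow> L_op \<omega> M' q e z t = 0"
  by (simp add: L_op_def cell_eq pre_cell_def)

text \<open>Lets measurability, boundedness and the error bound of \<open>L0_op\<close> be inherited
  from \<open>L_op\<close>.\<close>

lemma L0_op_eq: "L0_op \<omega> M' q e z t = (if t \<in> cell0_0 \<omega> M' q e then 0 else L_op \<omega> M' q e z t)"
  by (simp add: L0_op_def L_op_def cell0_def indicator_def)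

section \<open>Measurability and boundedness of the reconstructions\<close>

lemma tau_measurable:
  assumes \<omega>: "modulus_of_continuity \<omega>" and M': "closed M'"
  shows "tau \<omega> M' q e \<in> borel_measurable borel"
proof -
  have "(\<lambda>t. MIN j. e $ j + \<omega> (dist t (q j))) \<in> borel_measurable borel"
    by (intro borel_measurable_continuous_onI continuous_on_MIN_modulus[OF \<omega>])
  then show ?thesis
    unfolding tau_def by (rule measurable_If_set) (use borel_closed[OF M'] in simp_all)
qed

text \<open>A pre-cell is the part of \<open>M'\<close> where two Borel functions agree, and a cell
  is a finite Boolean combination of pre-cells.\<close>

lemma cell_in_borel:
  assumes \<omega>: "modulus_of_continuity \<omega>" and M': "closed M'"
  shows "cell \<omega> M' q e j \<in> sets borel"
proof -
  have "pre_cell \<omega> M' q e i \<in> sets borel" for i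
  proof -
    have "(\<lambda>t. e $ i + \<omega> (dist t (q i))) \<in> borel_measurable borel"
      by (intro borel_measurable_continuous_onI continuous_on_add continuous_on_const
          continuous_on_modulus_of_continuity[OF \<omega>] continuous_on_dist continuous_on_id zero_le_dist)
    then have "{t \<in> space borel. tau \<omega> M' q e t = e $ i + \<omega> (dist t (q i))} \<in> sets borel"
      by (rule borel_measurable_eq[OF tau_measurable[OF assms]])
    then have "M' \<inter> {t \<in> space borel. tau \<omega> M' q e t = e $ i + \<omega> (dist t (q i))} \<in> sets borel"
      by (rule sets.Int[OF borel_closed[OF M']])
    moreover have "pre_cell \<omega> M' q e i = M' \<inter> {t \<in> space borel. tau \<omega> M' q e t = e $ i + \<omega> (dist t (q i))}"
      by (auto simp: pre_cell_def)
    ultimately show ?thesis by simp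
  qed
  then show ?thesis
    unfolding cell_eq by (intro sets.Diff sets.finite_UN finite)
qed

lemma cell0_0_in_borel:
  assumes \<omega>: "modulus_of_continuity \<omega>" and M': "closed M'"
  shows "cell0_0 \<omega> M' q e \<in> sets borel"
proof (cases "frontier M' = {}")
  \<comment> \<open>The boundary modulus is infinite, so \<open>cell0_0\<close> is empty.\<close>
  case True
  then show ?thesis by (simp add: cell0_0_def boundary_modulus_def)
next
  case False
  have "(\<lambda>t. \<omega> (infdist t (frontier M'))) \<in> borel_measurable borel"
    by (intro borel_measurable_continuous_onI continuous_on_infdist continuous_on_id
        continuous_on_modulus_of_continuity[OF \<omega>] infdist_nonneg)
  then have "{t \<in> space borel. \<omega> (infdist t (frontier M')) \<le> tau \<omega> M' q e t} \<in> sets borel"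
    by (rule borel_measurable_le[OF _ tau_measurable[OF assms]])
  then have "M' \<inter> {t \<in> space borel. \<omega> (infdist t (frontier M')) \<le> tau \<omega> M' q e t} \<in> sets borel"
    by (rule sets.Int[OF borel_closed[OF M']])
  moreover have "cell0_0 \<omega> M' q e = M' \<inter> {t \<in> space borel. \<omega> (infdist t (frontier M')) \<le> tau \<omega> M' q e t}"
    using False by (auto simp: cell0_0_def boundary_modulus_def)
  ultimately show ?thesis by simp
qed

lemma L_op_measurable:
  assumes "modulus_of_continuity \<omega>" "closed M'"
  shows "L_op \<omega> M' q e z \<in> borel_measurable borel"
  unfolding L_op_def using cell_in_borel[OF assms] by measurable

lemma L_op_bounded: "\<bar>L_op \<omega> M' q e z t\<bar> \<le> (\<Sum>j\<in>UNIV. \<bar>z $ j\<bar>)"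
  unfolding L_op_def by (rule sum_abs[THEN order_trans]) (auto intro!: sum_mono simp: indicator_def)

lemma L_op_in_B_class:
  assumes \<mu>: "sets \<mu> = sets borel" and \<omega>: "modulus_of_continuity \<omega>" and M': "closed M'"
  shows "L_op \<omega> M' q e z \<in> B_class \<mu> M'"
  using L_op_measurable[OF \<omega> M'] L_op_bounded L_op_outside by (intro B_classI[OF \<mu> M'])

lemma L0_op_in_B_class:
  assumes \<mu>: "sets \<mu> = sets borel" and \<omega>: "modulus_of_continuity \<omega>" and M': "closed M'"
  shows "L0_op \<omega> M' q e z \<in> B_class \<mu> M'"
proof (rule B_classI[OF \<mu> M'])
  show "L0_op \<omega> M' q e z \<in> borel_measurable borel"
    unfolding L0_op_eq using cell0_0_in_borel[OF \<omega> M'] L_op_measurable[OF \<omega> M']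
    by (intro measurable_If_set) auto
  show "\<bar>L0_op \<omega> M' q e z t\<bar> \<le> (\<Sum>j\<in>UNIV. \<bar>z $ j\<bar>)" for t
    using L_op_bounded[of \<omega> M' q e z t] by (auto simp: L0_op_eq intro: sum_nonneg)
  show "L0_op \<omega> M' q e z t = 0" if "t \<notin> M'" for t
    using that by (simp add: L0_op_eq L_op_outside)
qed

section \<open>Pointwise error of the reconstructions\<close>

lemma L_op_error:
  assumes x: "x \<in> H_class \<omega> M'" and q: "range q \<subseteq> M'" and u: "u \<in> error_box e"
  shows "\<bar>x t - L_op \<omega> M' q e (info q x + u) t\<bar> \<le> tau \<omega> M' q e t"
proof (cases "t \<in> M'")
  case True
  then obtain j where j: "t \<in> cell \<omega> M' q e j" by (rule cell_cover)
  \<comment> \<open>The error splits into the oscillation of \<open>x\<close> between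
    \<open>t\<close> and \<open>q j\<close> and the data error \<open>u $ j\<close>; on this cell
    the two bounds add up to exactly \<open>tau\<close>.\<close>
  have "\<bar>x t - x (q j)\<bar> \<le> \<omega> (dist t (q j))"
    using x True q by (auto simp: H_class_def)
  moreover have "- (e $ j) \<le> u $ j" "u $ j \<le> e $ j"
    using u by (auto simp: error_box_def)
  moreover have "tau \<omega> M' q e t = e $ j + \<omega> (dist t (q j))"
    using j by (auto simp: cell_eq pre_cell_def)
  ultimately show ?thesis by (simp add: L_op_cell[OF j] info_def)
next
  case False
  then show ?thesis
    using x C_class_outside[of x M' t] by (auto simp: H_class_def L_op_outside tau_outside)
qed

text \<open>On \<open>cell0_0\<close> the reconstruction is 0 and \<open>tau0\<close> is the
  boundary term, which bounds \<open>x\<close> itself. Elsewhere in \<open>M'\<close> the minimum is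
  \<open>tau\<close>, off \<open>M'\<close> both \<open>tau\<close> and \<open>tau0\<close> vanish,
  and the bound for \<open>L_op\<close> applies.\<close>

lemma L0_op_error:
  assumes \<omega>: "modulus_of_continuity \<omega>" and M': "compact M'"
    and x: "x \<in> H0_class \<omega> M'" and q: "range q \<subseteq> M'" and u: "u \<in> error_box e"
  shows "\<bar>x t - L0_op \<omega> M' q e (info q x + u) t\<bar> \<le> tau0 \<omega> M' q e t"
proof (cases "t \<in> cell0_0 \<omega> M' q e")
  case True
  then have t: "t \<in> M'" and F: "frontier M' \<noteq> {}" and le: "\<omega> (infdist t (frontier M')) \<le> tau \<omega> M' q e t"
    by (auto simp: cell0_0_def boundary_modulus_def split: if_splits)
  then show ?thesis
    using H0_class_le_boundary_modulus[OF x M' t] True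
    by (simp add: L0_op_eq tau0_eq boundary_modulus_def)
next
  case False
  have xH: "x \<in> H_class \<omega> M'" using x by (simp add: H0_class_def)
  have "tau0 \<omega> M' q e t = tau \<omega> M' q e t"
  proof (cases "t \<in> M'")
    case True
    then show ?thesis
      using False by (cases "frontier M' = {}") (simp_all add: cell0_0_def boundary_modulus_def tau0_eq)
  next
    case False
    then show ?thesis by (simp add: tau0_outside[OF \<omega>] tau_outside)
  qed
  then show ?thesis using L_op_error[OF xH q u, of t] False by (simp add: L0_op_eq)
qed


theorem theorem3p1:
  fixes \<omega> :: "real \<Rightarrow> real"
    and e :: "real ^ 'k::{finite,linorder}"
    and q :: "'k \<Rightarrow> 'm::metric_space"
    and \<mu> :: "'m measure"
    and M' :: "'m set"
    and N :: "'n measure"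
    and A :: "('m \<Rightarrow> real) \<Rightarrow> 'n \<Rightarrow> real"
    and K :: "'n \<Rightarrow> 'm \<Rightarrow> real"
    and Y :: "('n \<Rightarrow> real) set"
    and nrm :: "('n \<Rightarrow> real) \<Rightarrow> real"
    and W :: "('m \<Rightarrow> real) set"
    and \<phi> :: "'m \<Rightarrow> real"
    and L :: "real ^ 'k::{finite,linorder} \<Rightarrow> 'm \<Rightarrow> real"
  assumes "modulus_of_continuity \<omega>"
    and "\<forall>j. 0 \<le> e $ j"
    and "sets \<mu> = sets borel" and "sigma_finite_measure \<mu>"
    and "compact M'"
    and "sigma_finite_measure N"
    and "integral_operator \<mu> N (B_class \<mu> M') A K"
    and "AE (s, t) in N \<Otimes>\<^sub>M \<mu>. 0 \<le> K s t"
    and "normed_lattice N Y nrm"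
    and "A ` B_class \<mu> M' \<subseteq> Y"
    and "range q \<subseteq> M'"
    and "W = H_class \<omega> M' \<and> \<phi> = tau \<omega> M' q e \<and> L = L_op \<omega> M' q e \<or>
         W = H0_class \<omega> M' \<and> \<phi> = tau0 \<omega> M' q e \<and> L = L0_op \<omega> M' q e"
  shows "optimal_recovery Y nrm A W (info q) (error_box e) (\<lambda>z. A (L z)) \<and>
         optimal_error Y nrm A W (info q) (error_box e) =
           recovery_error nrm A W (info q) (error_box e) (\<lambda>z. A (L z)) \<and>
         recovery_error nrm A W (info q) (error_box e) (\<lambda>z. A (L z)) =
           ereal (nrm (\<lambda>s. LINT t:M'|\<mu>. K s t * \<phi> t))"
proof -
  note \<omega> = assms(1) and e = assms(2) and \<mu> = assms(3,4) and M' = assms(5) and N = assms(6)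
    and A = assms(7) and K = assms(8) and nl = assms(9) and AY = assms(10) and q = assms(11)
    and cases = assms(12)
  have cl: "closed M'" using M' by (rule compact_imp_closed)
  have WH: "W \<subseteq> H_class \<omega> M'" using cases by (auto simp: H0_class_def)
  then have WB: "W \<subseteq> B_class \<mu> M'"
    using C_class_subset_B_class[OF \<mu>(1) M'] by (auto simp: H_class_def)
  have \<phi>W: "\<phi> \<in> W" "(\<lambda>t. - \<phi> t) \<in> W"
    using cases by (elim disjE conjE;
        simp add: tau_in_H_class[OF \<omega>] tau0_in_H0_class[OF \<omega> e cl] H_class_uminus H0_class_uminus)+
  have \<phi>B: "\<phi> \<in> B_class \<mu> M'" using \<phi>W WB by auto
  have \<phi>0: "\<phi> t = 0" if "t \<notin> M'" for t
    using that cases by (auto simp: tau_outside tau0_outside[OF \<omega>])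
  \<comment> \<open>At \<open>q j\<close> the \<open>j\<close>-th term of the minimum equals
    \<open>e $ j\<close>, since \<open>\<omega> 0 = 0\<close>.\<close>
  have "tau \<omega> M' q e (q j) \<le> e $ j" for j
    using tau_le[of "q j" M' \<omega> q e j] q \<omega> by (auto simp: modulus_of_continuity_def)
  then have \<phi>q: "\<bar>\<phi> (q j)\<bar> \<le> e $ j" for j
    using cases order_trans[OF tau0_le_tau[of \<omega> M' q e "q j"]]
    by (elim disjE conjE) (simp_all add: tau_nonneg[OF \<omega> e] tau0_nonneg[OF \<omega> e])
  have LB: "L z \<in> B_class \<mu> M'" for z
    using cases by (elim disjE conjE)
      (simp_all add: L_op_in_B_class[OF \<mu>(1) \<omega> cl] L0_op_in_B_class[OF \<mu>(1) \<omega> cl])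
  have le: "\<bar>x t - L (info q x + u) t\<bar> \<le> \<phi> t" if "x \<in> W" "u \<in> error_box e" for x u t
    using cases that by (elim disjE conjE) (simp_all add: L_op_error[OF _ q] L0_op_error[OF \<omega> M' _ q])
  note opt = optimal_recovery_extremal[OF \<mu>(2) N A K nl AY WB LB \<phi>W \<phi>q le]
  have int_eq: "(LINT t:M'|\<mu>. K s t * \<phi> t) = (LINT t|\<mu>. K s t * \<phi> t)" for s
    unfolding set_lebesgue_integral_def
    by (rule Bochner_Integration.integral_cong) (use \<phi>0 in \<open>auto simp: indicator_def\<close>)
  have "ae_eq N (A \<phi>) (\<lambda>s. LINT t:M'|\<mu>. K s t * \<phi> t)"
    using integral_operatorD[OF A \<phi>B] unfolding ae_eq_def int_eq by eventually_elim simp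
  \<comment> \<open>\<open>Y\<close> is closed under almost everywhere equality only among
    measurable functions, so this puts the kernel integral into \<open>Y\<close> and gives its norm
    a meaning.\<close>
  moreover have "(\<lambda>s. LINT t:M'|\<mu>. K s t * \<phi> t) \<in> borel_measurable N"
  proof -
    interpret sigma_finite_measure \<mu> by (rule \<mu>(2))
    have [measurable]: "case_prod K \<in> borel_measurable (N \<Otimes>\<^sub>M \<mu>)" "\<phi> \<in> borel_measurable \<mu>"
      using A \<phi>B by (auto simp: integral_operator_def B_class_def)
    show ?thesis unfolding int_eq by measurable
  qed
  moreover have AY\<phi>: "A \<phi> \<in> Y" using AY \<phi>B by auto
  ultimately have "nrm (A \<phi>) = nrm (\<lambda>s. LINT t:M'|\<mu>. K s t * \<phi> t)"
    using normed_lattice_norm_cong[OF nl AY\<phi>] normed_latticeD(2)[OF nl AY\<phi>] by blast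
  then show ?thesis using opt by (simp add: optimal_recovery_def)
qed

end
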